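(* For any integer $m\ge 2$, let $M_m$ be the $(m-1)\times(m-1)$ matrix whose $(i,j)$-entry ($1\le i,j\le m-1$) is \[ (M_m)_{i,j}=\binom{m}{2i-j}, \] with the convention $\binom{m}{k}=0$ whenever $k<0$ or $k>m$. Then \[ \det(M_m)=2^{\,m(m-1)/2}. \]
   Context: Matrix rows and columns are indexed from $1$. The index $2i-j$ may be negative or exceed $m$ as an integer; the binomial coefficient is then $0$. *)

theory Defs
  imports "Jordan_Normal_Form.Determinant"
begin

definition binom_int :: "nat \<Rightarrow> int \<Rightarrow> int" where
  "binom_int m k = (if 0 \<le> k \<and> k \<le> int m then int (m choose nat k) else 0)"

text \<open>Matrix indices start at 0 in the library, so position \<open>(i, j)\<close> below is the
  entry in row \<open>i + 1\<close> and column \<open>j + 1\<close> of the matrix with rows and columns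
  numbered from 1.\<close>

definition binom_matrix :: "nat \<Rightarrow> int mat" where
  "binom_matrix m = mat (m - 1) (m - 1)
     (\<lambda>(i, j). binom_int m (2 * int (i + 1) - int (j + 1)))"

end

theory Submission
  imports Defs "Jordan_Normal_Form.Char_Poly"
    "HOL-Computational_Algebra.Formal_Power_Series"
begin

text \<open>The matrix represents the operator sending \<open>p\<close> to the even part of \<open>(1 + X) ^ m * p\<close>
  (with \<open>X\<^sup>2\<close> replaced by \<open>X\<close>) on the span of \<open>X, \<dots>, X ^ (m - 1)\<close>. For \<open>0 < k < m\<close> the
  power series \<open>p = (1 - X) ^ m * (\<Sum>n. n ^ k * X ^ n)\<close> lies in this span, and since
  \<open>(1 + X) ^ m * p = (1 - X\<^sup>2) ^ m * (\<Sum>n. n ^ k * X ^ n)\<close>, it is an eigenvector for \<open>2 ^ k\<close>.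
  These are \<open>m - 1\<close> distinct eigenvalues, so the determinant is their product.\<close>

text \<open>General \<open>c\<close> and \<open>d\<close> cover the three powers that occur later:
  of 1 - X, 1 + X and 1 - X^2.\<close>

lemma fps_one_plus_power_nth:
  fixes c :: "'a :: comm_ring_1"
  assumes "d > 0"
  shows "fps_nth ((1 + fps_const c * fps_X ^ d) ^ m) n =
    (if d dvd n then of_nat (m choose (n div d)) * c ^ (n div d) else 0)"
proof -
  have "fps_nth ((1 + fps_const c * fps_X ^ d) ^ m) n =
      (\<Sum>k\<le>m. of_nat (m choose k) * (c ^ k * (if n = d * k then 1 else 0)))"
    unfolding add.commute[of 1] binomial_ring
    by (simp add: fps_sum_nth power_mult_distrib fps_of_nat[symmetric] fps_const_power
        power_mult[symmetric] mult.assoc del: fps_const_power[symmetric])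
  also have "\<dots> = (if d dvd n then of_nat (m choose (n div d)) * c ^ (n div d) else 0)"
  proof (cases "d dvd n")
    case True
    then obtain q where q: "n = d * q" ..
    have "(\<Sum>k\<le>m. of_nat (m choose k) * (c ^ k * (if n = d * k then 1 else 0))) =
        (\<Sum>k\<le>m. if k = q then of_nat (m choose q) * c ^ q else 0)"
      using assms q by (intro sum.cong) auto
    then show ?thesis
      using assms q by (auto simp: binomial_eq_0)
  qed (auto intro!: sum.neutral)
  finally show ?thesis .
qed

text \<open>An \<open>m\<close>-th finite difference kills polynomials of degree below
  \<open>m\<close>. The induction splits off one factor \<open>x - of_nat i\<close>; its two parts
  need the hypothesis at \<open>(m, x)\<close> and at \<open>(m - 1, x - 1)\<close>, so both
  vary.\<close>

lemma alternating_binomial_sum_power_eq_0: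
  fixes x :: "'a :: comm_ring_1"
  assumes "k < m"
  shows "(\<Sum>i\<le>m. (-1) ^ i * of_nat (m choose i) * (x - of_nat i) ^ k) = 0"
  using assms
proof (induction k arbitrary: m x)
  case 0
  then show ?case
    using choose_alternating_sum[of m, where ?'a = 'a] by simp
next
  case (Suc k)
  obtain m' where m: "m = Suc m'"
    using Suc.prems by (cases m) auto
  have absorb: "of_nat (m choose Suc i) * of_nat (Suc i) = (of_nat m * of_nat (m' choose i) :: 'a)" for i
    unfolding m of_nat_mult[symmetric] by (simp only: Suc_times_binomial_eq)
  have "(\<Sum>i\<le>m. (-1) ^ i * of_nat (m choose i) * (x - of_nat i) ^ Suc k) =
      x * (\<Sum>i\<le>m. (-1) ^ i * of_nat (m choose i) * (x - of_nat i) ^ k) -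
      (\<Sum>i\<le>m. (-1) ^ i * (of_nat (m choose i) * of_nat i) * (x - of_nat i) ^ k)"
    unfolding sum_distrib_left sum_subtractf[symmetric]
    by (intro sum.cong) (auto simp: algebra_simps)
  \<comment> \<open>The term at 0 vanishes through the factor \<open>of_nat i\<close>; shifting the
    rest by one flips the sign and turns \<open>x\<close> into \<open>x - 1\<close>.\<close>
  also have "(\<Sum>i\<le>m. (-1) ^ i * (of_nat (m choose i) * of_nat i) * (x - of_nat i) ^ k) =
      - of_nat m * (\<Sum>i\<le>m'. (-1) ^ i * of_nat (m' choose i) * (x - 1 - of_nat i) ^ k)"
    unfolding m sum.atMost_Suc_shift absorb[unfolded m] sum_distrib_left
    by (auto intro!: sum.cong simp: algebra_simps)
  finally show ?case
    using Suc.IH[of m x] Suc.IH[of m' "x - 1"] Suc.prems by (simp add: m)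
qed

text \<open>The characteristic polynomial and the product of the X - a over \<open>S\<close> are
  both monic of degree \<open>n\<close> and agree at the \<open>n\<close> points of
  \<open>S\<close>, hence are equal. Evaluating at 0 gives the determinant up to the sign
  \<open>(-1) ^ n\<close> on both sides.\<close>

lemma det_eq_prod_eigenvalues:
  fixes A :: "'a :: field mat"
  assumes A: "A \<in> carrier_mat n n" and S: "finite S" "card S = n"
    and ev: "\<And>a. a \<in> S \<Longrightarrow> eigenvalue A a"
  shows "det A = \<Prod>S"
proof -
  let ?p = "\<Prod>a\<in>S. [:-a, 1:]"
  have deg: "degree ?p = n"
    using S by (subst degree_prod_eq_sum_degree) auto
  have "lead_coeff ?p = 1"
    unfolding lead_coeff_prod by simp
  then have "char_poly A = ?p"
    using degree_monic_char_poly[OF A] deg S eigenvalue_root_char_poly[OF A] ev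
    by (intro poly_eqI_degree_lead_coeff[of _ n _ S]) (auto simp: poly_prod)
  then have "poly (char_poly A) 0 = (\<Prod>a\<in>S. - a)"
    by (simp add: poly_prod)
  also have "\<dots> = (-1) ^ n * \<Prod>S"
    using S prod.distrib[of "\<lambda>_. -1" "\<lambda>a. a" S] by simp
  also have "poly (char_poly A) 0 = det ((-1) \<cdot>\<^sub>m A)"
    unfolding char_poly_matrix[OF A]
    by (rule arg_cong[where f = det], rule eq_matI) (use A in \<open>auto simp: char_matrix_def\<close>)
  also have "\<dots> = (-1) ^ n * det A"
    using A by simp
  finally show ?thesis
    by simp
qed

text \<open>For \<open>0 < k < m\<close> this is a polynomial, namely \<open>(1 - X) ^ (m - 1 - k)\<close> times the
  \<open>k\<close>-th Eulerian polynomial in the normalisation with lowest term \<open>X\<close>.\<close>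

definition eulerian_fps :: "nat \<Rightarrow> nat \<Rightarrow> int fps" where
  "eulerian_fps m k = (1 - fps_X) ^ m * Abs_fps (\<lambda>n. of_nat n ^ k)"

lemma eulerian_fps_nth:
  "fps_nth (eulerian_fps m k) n =
    (\<Sum>i\<le>n. (-1) ^ i * of_nat (m choose i) * of_nat (n - i) ^ k)"
  using fps_one_plus_power_nth[of 1 "-1 :: int" m]
  by (simp add: eulerian_fps_def fps_mult_nth atLeast0AtMost mult.commute
      flip: fps_const_neg)

lemma eulerian_fps_nth_0: "k > 0 \<Longrightarrow> fps_nth (eulerian_fps m k) 0 = 0"
  by (simp add: eulerian_fps_nth)

lemma eulerian_fps_nth_1: "k > 0 \<Longrightarrow> fps_nth (eulerian_fps m k) 1 = 1"
  by (simp add: eulerian_fps_nth)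

text \<open>From \<open>m\<close> on, the convolution contains all terms with
  \<open>i \<le> m\<close> and the natural subtraction is exact, so the coefficient is a full
  \<open>m\<close>-th difference of a \<open>k\<close>-th power.\<close>

lemma eulerian_fps_nth_eq_0:
  assumes "k < m" "m \<le> n"
  shows "fps_nth (eulerian_fps m k) n = 0"
proof -
  have "fps_nth (eulerian_fps m k) n =
      (\<Sum>i\<le>m. (-1) ^ i * of_nat (m choose i) * of_nat (n - i) ^ k)"
    unfolding eulerian_fps_nth
    using assms by (intro sum.mono_neutral_right) (auto simp: binomial_eq_0)
  also have "\<dots> = (\<Sum>i\<le>m. (-1) ^ i * of_nat (m choose i) * (int n - of_nat i) ^ k)"
    using assms by (intro sum.cong) (auto simp: of_nat_diff)
  finally show ?thesis
    using alternating_binomial_sum_power_eq_0[OF assms(1)] by simp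
qed

text \<open>Compare coefficients at exponent \<open>2 * i\<close> in (1 + X)^m (1 - X)^m = (1 -
  X^2)^m, times the series of \<open>k\<close>-th powers. Only even exponents \<open>2 * b\<close>
  survive on the right, and doubling \<open>i - b\<close> yields the factor
  \<open>2 ^ k\<close>.\<close>

lemma eulerian_fps_bisection:
  "(\<Sum>j\<le>2 * i. of_nat (m choose (2 * i - j)) * fps_nth (eulerian_fps m k) j) =
    2 ^ k * fps_nth (eulerian_fps m k) i"
proof -
  let ?N = "Abs_fps (\<lambda>n. of_nat n ^ k) :: int fps"
  have plus: "fps_nth ((1 + fps_X) ^ m) n = int (m choose n)" for n
    using fps_one_plus_power_nth[of 1 "1 :: int" m n] by simp
  have square: "fps_nth ((1 - fps_X ^ 2) ^ m) n =
      (if even n then int (m choose (n div 2)) * (-1) ^ (n div 2) else 0)" for n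
    using fps_one_plus_power_nth[of 2 "-1 :: int" m n] by (simp flip: fps_const_neg)
  have "eulerian_fps m k * (1 + fps_X) ^ m = ((1 - fps_X) * (1 + fps_X)) ^ m * ?N"
    by (simp add: eulerian_fps_def power_mult_distrib mult_ac)
  also have "(1 - fps_X) * (1 + fps_X) = (1 - fps_X ^ 2 :: int fps)"
    by (simp add: algebra_simps power2_eq_square)
  finally have eq: "eulerian_fps m k * (1 + fps_X) ^ m = (1 - fps_X ^ 2) ^ m * ?N" .
  have "(\<Sum>j\<le>2 * i. of_nat (m choose (2 * i - j)) * fps_nth (eulerian_fps m k) j) =
      fps_nth (eulerian_fps m k * (1 + fps_X) ^ m) (2 * i)"
    by (simp add: fps_mult_nth plus atLeast0AtMost mult.commute)
  also have "\<dots> = (\<Sum>a\<le>2 * i. fps_nth ((1 - fps_X ^ 2) ^ m) a * of_nat (2 * i - a) ^ k)"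
    unfolding eq by (simp add: fps_mult_nth atLeast0AtMost)
  also have "\<dots> = (\<Sum>a\<in>(*) 2 ` {..i}. fps_nth ((1 - fps_X ^ 2) ^ m) a * of_nat (2 * i - a) ^ k)"
    by (rule sum.mono_neutral_right) (auto simp: square elim!: evenE)
  also have "\<dots> = (\<Sum>b\<le>i. (-1) ^ b * of_nat (m choose b) * of_nat (2 * i - 2 * b) ^ k)"
    by (subst sum.reindex) (auto simp: square inj_on_def mult.commute)
  also have "\<dots> = (\<Sum>b\<le>i. 2 ^ k * ((-1) ^ b * of_nat (m choose b) * of_nat (i - b) ^ k))"
  proof (intro sum.cong refl)
    fix b
    have "int (2 * i - 2 * b) = 2 * int (i - b)"
      by (simp add: diff_mult_distrib2[symmetric] del: of_nat_diff)
    then show "(-1) ^ b * of_nat (m choose b) * int (2 * i - 2 * b) ^ k =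
        2 ^ k * ((-1) ^ b * of_nat (m choose b) * int (i - b) ^ k)"
      by (simp only: power_mult_distrib mult_ac)
  qed
  finally show ?thesis
    by (simp add: eulerian_fps_nth sum_distrib_left)
qed

text \<open>Above \<open>m\<close> the natural binomial coefficient is already 0, so only a negative
  index remains as a separate case.\<close>

lemma binom_int_of_nat_diff:
  "binom_int m (int a - int b) = (if b \<le> a then int (m choose (a - b)) else 0)"
  by (auto simp: binom_int_def nat_diff_distrib binomial_eq_0)

lemma eigenvector_binom_matrix:
  assumes "0 < k" "k < m"
  shows "eigenvector (binom_matrix m) (vec (m - 1) (\<lambda>i. fps_nth (eulerian_fps m k) (i + 1))) (2 ^ k)"
proof -
  let ?e = "fps_nth (eulerian_fps m k)" and ?v = "vec (m - 1) (\<lambda>i. fps_nth (eulerian_fps m k) (i + 1))"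
  \<comment> \<open>The entry at position 0 is the coefficient of X, which is 1.\<close>
  have "?v $ 0 \<noteq> 0"
    using assms eulerian_fps_nth_1[of k m] by simp
  then have nz: "?v \<noteq> 0\<^sub>v (m - 1)"
    using assms by (metis index_zero_vec(1) less_one linorder_neqE_nat not_less_zero
        order_le_less_trans zero_less_diff Suc_leI One_nat_def)
  have "binom_matrix m *\<^sub>v ?v = 2 ^ k \<cdot>\<^sub>v ?v"
  proof (rule eq_vecI)
    fix i assume "i < dim_vec (2 ^ k \<cdot>\<^sub>v ?v)"
    then have i: "i < m - 1" by simp
    let ?b = "\<lambda>j. binom_int m (int (2 * (i + 1)) - int j)"
    have "(binom_matrix m *\<^sub>v ?v) $ i = (\<Sum>j<m - 1. ?b (Suc j) * ?e (Suc j))"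
      using i by (simp add: binom_matrix_def scalar_prod_def atLeast0LessThan)
    also have "\<dots> = (\<Sum>j\<in>Suc ` {..<m - 1}. ?b j * ?e j)"
      by (subst sum.reindex) auto
    also have "Suc ` {..<m - 1} = {1..<m}"
      unfolding image_Suc_lessThan using assms by auto
    \<comment> \<open>The maximum makes the range contain both index sets. The added coefficients
      \<open>?e j\<close> vanish, at 0 since \<open>0 < k\<close> and from \<open>m\<close> on since
      \<open>k < m\<close>; the next step discards \<open>j > 2 * (i + 1)\<close>, where
      \<open>?b j\<close> is 0.\<close>
    also have "(\<Sum>j\<in>{1..<m}. ?b j * ?e j) = (\<Sum>j\<le>max m (2 * (i + 1)). ?b j * ?e j)"
    proof (rule sum.mono_neutral_left)
      show "\<forall>j\<in>{..max m (2 * (i + 1))} - {1..<m}. ?b j * ?e j = 0"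
      proof
        fix j assume "j \<in> {..max m (2 * (i + 1))} - {1..<m}"
        then have "j = 0 \<or> m \<le> j" by auto
        then show "?b j * ?e j = 0"
          using assms eulerian_fps_nth_0 eulerian_fps_nth_eq_0 by auto
      qed
    qed auto
    also have "\<dots> = (\<Sum>j\<le>2 * (i + 1). of_nat (m choose (2 * (i + 1) - j)) * ?e j)"
      unfolding binom_int_of_nat_diff by (rule sum.mono_neutral_cong_right) auto
    also have "\<dots> = (2 ^ k \<cdot>\<^sub>v ?v) $ i"
      using i unfolding eulerian_fps_bisection by simp
    finally show "(binom_matrix m *\<^sub>v ?v) $ i = (2 ^ k \<cdot>\<^sub>v ?v) $ i" .
  qed (simp add: binom_matrix_def)
  then show ?thesis
    using nz by (simp add: eigenvector_def binom_matrix_def)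
qed

theorem theorem1:
  fixes m :: nat
  assumes "m \<ge> 2"
  shows "det (binom_matrix m) = 2 ^ (m * (m - 1) div 2)"
proof -
  \<comment> \<open>The eigenvalue argument works over a field, so the integer matrix is mapped to
    the rationals; injectivity of the embedding brings the result back.\<close>
  let ?S = "(\<lambda>k. 2 ^ k :: rat) ` {1..<m}"
  have inj: "inj_on (\<lambda>k. 2 ^ k :: rat) {1..<m}"
    by (simp add: inj_on_def)
  have M: "binom_matrix m \<in> carrier_mat (m - 1) (m - 1)"
    by (simp add: binom_matrix_def)
  have "eigenvalue (map_mat rat_of_int (binom_matrix m)) (2 ^ k)" if "k \<in> {1..<m}" for k
    using of_int_hom.eigenvector_hom[OF M eigenvector_binom_matrix[of k m]] that
    by (auto simp: eigenvalue_def)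
  then have "det (map_mat rat_of_int (binom_matrix m)) = \<Prod>?S"
    using M inj by (intro det_eq_prod_eigenvalues[of _ "m - 1"]) (auto simp: card_image)
  also have "\<dots> = 2 ^ (\<Sum>k\<in>{1..<m}. k)"
    using inj by (simp add: prod.reindex power_sum)
  also have "(\<Sum>k\<in>{1..<m}. k) = (\<Sum>k\<in>{0..<m}. k)"
    by (rule sum.mono_neutral_left) auto
  also have "\<dots> = m * (m - 1) div 2"
    using Sum_Ico_nat[of 0 m] by simp
  finally have "rat_of_int (det (binom_matrix m)) = rat_of_int (2 ^ (m * (m - 1) div 2))"
    by simp
  then show ?thesis
    by (simp only: of_int_eq_iff)
qed

end
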